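(* For problems (P): $\min_x f(x)$ subject to $g(x)\le 0$, with locally Lipschitz continuous $f$ and $g=(g_1,\dots,g_q)$, subMFC at a feasible point $\bar x$ does not imply calmness in the sense of Clarke at $\bar x$. That is, there exist an instance of (P) and a feasible point $\bar x$ that solves it such that subMFC holds at $\bar x$ but (P) is not calm at $\bar x$.
   Context: In (P), $f:\mathbb{R}^n\to\mathbb{R}$ and $g:\mathbb{R}^n\to\mathbb{R}^q$. Inequalities between vectors are componentwise; sums and multiples of sets are in the Minkowski sense, and an empty sum is $\{0\}$. For a locally Lipschitz $\phi:\mathbb{R}^n\to\mathbb{R}$, $\partial\phi(\bar x)$ is the Clarke subdifferential: $\partial\phi(\bar x)=\{s\in\mathbb{R}^n : s^\top d\le \phi^\circ(\bar x;d)\ \forall d\in\mathbb{R}^n\}$ with $\phi^\circ(\bar x;d)=\limsup_{x\to\bar x,\,h\downarrow 0}\frac{\phi(x+hd)-\phi(x)}{h}$. AKKT sequence for $\bar x$: a sequence $\{(x^k,u^k,\delta^k,\epsilon^k)\}_{k=1}^\infty\subset\mathbb{R}^n\times\mathbb{R}^q\times\mathbb{R}^q\times\mathbb{R}^n$ such that for all $k\in\mathbb{N}$: $\epsilon^k\in\partial f(x^k)+\sum_{j=1}^q u^k_j\partial g_j(x^k)$, $u^k\ge 0$, $g(x^k)\le\delta^k$, $(u^k)^\top(g(x^k)-\delta^k)=0$; and $(x^k,\delta^k,\epsilon^k)\to(\bar x,0,0)$ as $k\to\infty$. Active sets: $I(\bar x)=\{j\in\{1,\dots,q\}: g_j(\bar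 x)=0\}$; for $g(x)\le\delta$, $I(x,\delta)=\{j\in\{1,\dots,q\}: g_j(x)=\delta_j\}$. subMFC (Subset Mangasarian-Fromovitz Condition) holds at a feasible point $\bar x$ if there exists $I\subseteq I(\bar x)$ such that: (i) if $I\neq\emptyset$, then for all $v=(v_j)_{j\in I}\ge 0$, $v\ne 0$, one has $0\notin\sum_{j\in I}v_j\partial g_j(\bar x)$; (ii) there exists an AKKT sequence for $\bar x$ with $I=I(x^k,\delta^k)$ for all $k\in\mathbb{N}$. Calmness: let $\bar x$ solve (P). Then (P) is calm at $\bar x$ (in the sense of Clarke) if there exist $r>0$ and $\mu>0$ such that for all $\alpha\in B(0,r)\subset\mathbb{R}^q$ and all $x\in B(\bar x,r)$ with $g(x)+\alpha\le 0$ one has $f(x)-f(\bar x)+\mu\|\alpha\|\ge 0$. Here $B(\cdot,r)$ are closed Euclidean balls and $\|\cdot\|$ is the Euclidean norm. *)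

theory Defs
  imports
    "HOL-Analysis.Analysis"
    "HOL-Library.Function_Algebras"
    "HOL-Library.Set_Algebras"
begin

text \<open>
  The dimensions \<open>n\<close> and \<open>q\<close> belong to the problem instance and have to be quantified over,
  so \<open>\<real>\<^sup>n\<close> is the carrier of the topology \<^const>\<open>Euclidean_space\<close>: functions on \<^typ>\<open>nat\<close> that
  vanish at all indices \<open>i \<ge> n\<close>. Coordinates are therefore numbered from \<open>0\<close> to \<open>n - 1\<close>.
  Since the remaining entries are \<open>0\<close>, the pointwise order, sum, difference and zero of functions
  are the componentwise ones of \<open>\<real>\<^sup>n\<close>, and \<open>+\<close> and \<open>\<Sum>\<close> on sets of vectors are Minkowski sums
  with empty sum \<open>{0}\<close>.
\<close>

abbreviation Rn :: "nat \<Rightarrow> (nat \<Rightarrow> real) set"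
  where "Rn n \<equiv> topspace (Euclidean_space n)"

definition scale_vec :: "real \<Rightarrow> (nat \<Rightarrow> real) \<Rightarrow> (nat \<Rightarrow> real)"  (infixr "*\<^sub>v" 75)
  where "c *\<^sub>v x = (\<lambda>i. c * x i)"

definition inner_Rn :: "nat \<Rightarrow> (nat \<Rightarrow> real) \<Rightarrow> (nat \<Rightarrow> real) \<Rightarrow> real"
  where "inner_Rn n x y = (\<Sum>i<n. x i * y i)"

definition norm_Rn :: "nat \<Rightarrow> (nat \<Rightarrow> real) \<Rightarrow> real"
  where "norm_Rn n x = L2_set x {..<n}"

definition cball_Rn :: "nat \<Rightarrow> (nat \<Rightarrow> real) \<Rightarrow> real \<Rightarrow> (nat \<Rightarrow> real) set"
  where "cball_Rn n x r = {y \<in> Rn n. norm_Rn n (y - x) \<le> r}"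

definition locally_Lipschitz_Rn :: "nat \<Rightarrow> ((nat \<Rightarrow> real) \<Rightarrow> real) \<Rightarrow> bool"
  where "locally_Lipschitz_Rn n \<phi> \<longleftrightarrow>
    (\<forall>x\<in>Rn n. \<exists>r>0. \<exists>L\<ge>0. \<forall>y\<in>cball_Rn n x r. \<forall>z\<in>cball_Rn n x r.
       \<bar>\<phi> y - \<phi> z\<bar> \<le> L * norm_Rn n (y - z))"

text \<open>The base point \<open>y\<close> of the difference quotient may equal \<open>x\<close>: \<^const>\<open>nhdsin\<close> is not punctured.\<close>

definition clarke_dderiv ::
    "nat \<Rightarrow> ((nat \<Rightarrow> real) \<Rightarrow> real) \<Rightarrow> (nat \<Rightarrow> real) \<Rightarrow> (nat \<Rightarrow> real) \<Rightarrow> ereal"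
  where "clarke_dderiv n \<phi> x d =
    Limsup (nhdsin (Euclidean_space n) x \<times>\<^sub>F at_right (0::real))
      (\<lambda>(y, h). ereal ((\<phi> (y + h *\<^sub>v d) - \<phi> y) / h))"

definition clarke_subdiff ::
    "nat \<Rightarrow> ((nat \<Rightarrow> real) \<Rightarrow> real) \<Rightarrow> (nat \<Rightarrow> real) \<Rightarrow> (nat \<Rightarrow> real) set"
  where "clarke_subdiff n \<phi> x =
    {s \<in> Rn n. \<forall>d\<in>Rn n. ereal (inner_Rn n s d) \<le> clarke_dderiv n \<phi> x d}"

text \<open>
  An instance of (P) is given by \<open>n\<close>, \<open>q\<close>, \<open>f\<close> and \<open>g\<close>; the \<open>j\<close>-th constraint function is
  \<open>\<lambda>y. g y j\<close>. Only the values of \<open>f\<close> and \<open>g\<close> on \<open>Rn n\<close> matter.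
\<close>

definition locally_Lipschitz_problem ::
    "nat \<Rightarrow> nat \<Rightarrow> ((nat \<Rightarrow> real) \<Rightarrow> real) \<Rightarrow> ((nat \<Rightarrow> real) \<Rightarrow> (nat \<Rightarrow> real)) \<Rightarrow> bool"
  where "locally_Lipschitz_problem n q f g \<longleftrightarrow>
    g \<in> Rn n \<rightarrow> Rn q \<and> locally_Lipschitz_Rn n f \<and> (\<forall>j<q. locally_Lipschitz_Rn n (\<lambda>y. g y j))"

definition feasible :: "nat \<Rightarrow> ((nat \<Rightarrow> real) \<Rightarrow> (nat \<Rightarrow> real)) \<Rightarrow> (nat \<Rightarrow> real) \<Rightarrow> bool"
  where "feasible n g x \<longleftrightarrow> x \<in> Rn n \<and> g x \<le> 0"

definition solves ::
    "nat \<Rightarrow> ((nat \<Rightarrow> real) \<Rightarrow> real) \<Rightarrow> ((nat \<Rightarrow> real) \<Rightarrow> (nat \<Rightarrow> real)) \<Rightarrow> (nat \<Rightarrow> real) \<Rightarrow> bool"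
  where "solves n f g x \<longleftrightarrow> feasible n g x \<and> (\<forall>y. feasible n g y \<longrightarrow> f x \<le> f y)"

definition active ::
    "nat \<Rightarrow> ((nat \<Rightarrow> real) \<Rightarrow> (nat \<Rightarrow> real)) \<Rightarrow> (nat \<Rightarrow> real) \<Rightarrow> (nat \<Rightarrow> real) \<Rightarrow> nat set"
  where "active q g x \<delta> = {j. j < q \<and> g x j = \<delta> j}"

definition AKKT_sequence ::
    "nat \<Rightarrow> nat \<Rightarrow> ((nat \<Rightarrow> real) \<Rightarrow> real) \<Rightarrow> ((nat \<Rightarrow> real) \<Rightarrow> (nat \<Rightarrow> real)) \<Rightarrow> (nat \<Rightarrow> real) \<Rightarrow>
     (nat \<Rightarrow> nat \<Rightarrow> real) \<Rightarrow> (nat \<Rightarrow> nat \<Rightarrow> real) \<Rightarrow> (nat \<Rightarrow> nat \<Rightarrow> real) \<Rightarrow> (nat \<Rightarrow> nat \<Rightarrow> real) \<Rightarrow> bool"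
  where "AKKT_sequence n q f g xb x u \<delta> \<epsilon> \<longleftrightarrow>
    (\<forall>k. x k \<in> Rn n \<and> u k \<in> Rn q \<and> \<delta> k \<in> Rn q \<and> \<epsilon> k \<in> Rn n \<and>
       \<epsilon> k \<in> clarke_subdiff n f (x k)
             + (\<Sum>j<q. (*\<^sub>v) (u k j) ` clarke_subdiff n (\<lambda>y. g y j) (x k)) \<and>
       0 \<le> u k \<and> g (x k) \<le> \<delta> k \<and> inner_Rn q (u k) (g (x k) - \<delta> k) = 0) \<and>
    limitin (Euclidean_space n) x xb sequentially \<and>
    limitin (Euclidean_space q) \<delta> 0 sequentially \<and>
    limitin (Euclidean_space n) \<epsilon> 0 sequentially"

definition subMFC ::
    "nat \<Rightarrow> nat \<Rightarrow> ((nat \<Rightarrow> real) \<Rightarrow> real) \<Rightarrow> ((nat \<Rightarrow> real) \<Rightarrow> (nat \<Rightarrow> real)) \<Rightarrow> (nat \<Rightarrow> real) \<Rightarrow> bool"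
  where "subMFC n q f g xb \<longleftrightarrow>
    (\<exists>I. I \<subseteq> active q g xb 0 \<and>
       (I \<noteq> {} \<longrightarrow>
          (\<forall>v :: nat \<Rightarrow> real. (\<forall>j\<in>I. 0 \<le> v j) \<and> (\<exists>j\<in>I. v j \<noteq> 0) \<longrightarrow>
             0 \<notin> (\<Sum>j\<in>I. (*\<^sub>v) (v j) ` clarke_subdiff n (\<lambda>y. g y j) xb))) \<and>
       (\<exists>x u \<delta> \<epsilon>. AKKT_sequence n q f g xb x u \<delta> \<epsilon> \<and> (\<forall>k. I = active q g (x k) (\<delta> k))))"

definition Clarke_calm ::
    "nat \<Rightarrow> nat \<Rightarrow> ((nat \<Rightarrow> real) \<Rightarrow> real) \<Rightarrow> ((nat \<Rightarrow> real) \<Rightarrow> (nat \<Rightarrow> real)) \<Rightarrow> (nat \<Rightarrow> real) \<Rightarrow> bool"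
  where "Clarke_calm n q f g xb \<longleftrightarrow>
    (\<exists>r>0. \<exists>\<mu>>0. \<forall>\<alpha>\<in>cball_Rn q 0 r. \<forall>x\<in>cball_Rn n xb r.
       g x + \<alpha> \<le> 0 \<longrightarrow> f x - f xb + \<mu> * norm_Rn q \<alpha> \<ge> 0)"

end

theory Submission
  imports Defs
begin

text \<open>
  On the real line, minimise \<open>f(x) = -|x|\<close> subject to \<open>x\<^sup>2 \<le> 0\<close>: the only feasible point is
  \<open>0\<close>. Relaxing the constraint to \<open>x\<^sup>2 \<le> t\<^sup>2\<close> lowers the value by \<open>t\<close>, which no multiple of
  \<open>t\<^sup>2\<close> compensates for small \<open>t\<close>, so calmness fails. On the other hand \<open>0\<close> is the maximiser
  of \<open>f\<close>, so \<open>0 \<in> \<partial>f(0)\<close>, and the constant sequence at \<open>0\<close> with zero multipliers and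
  \<open>\<delta>\<^sup>k > 0\<close> is an AKKT sequence along which no constraint is active; hence subMFC holds with
  \<open>I = \<emptyset>\<close>.
\<close>

lemma mem_Rn_iff: "x \<in> Rn n \<longleftrightarrow> (\<forall>i\<ge>n. x i = 0)"
  by (simp add: topspace_Euclidean_space)

text \<open>The Euclidean topology is the subspace topology inherited from the product topology on
  real sequences, and product convergence is coordinatewise.\<close>

lemma limitin_Euclidean_space_iff:
  "limitin (Euclidean_space n) f l F \<longleftrightarrow>
     l \<in> Rn n \<and> (\<forall>\<^sub>F h in F. f h \<in> Rn n) \<and> (\<forall>i. ((\<lambda>h. f h i) \<longlongrightarrow> l i) F)"
  by (auto simp: Euclidean_space_def limitin_subtopology limitin_componentwise
      elim: eventually_mono)

text \<open>Supplies test points approaching \<open>x\<close> along \<open>d\<close>: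
  \<open>c = 1\<close> at a minimum, \<open>c = -1\<close> at a maximum.\<close>

lemma limitin_line:
  assumes "x \<in> Rn n" "d \<in> Rn n"
  shows "limitin (Euclidean_space n) (\<lambda>h. x + (c * h) *\<^sub>v d) x (at_right 0)"
proof -
  have "((\<lambda>h. x i + c * h * d i) \<longlongrightarrow> x i) (at_right 0)" for i
    by (auto intro!: tendsto_eq_intros)
  then show ?thesis
    using assms by (simp add: limitin_Euclidean_space_iff mem_Rn_iff scale_vec_def)
qed

lemma eventually_limitin_nhdsin:
  assumes "limitin X f l F" "eventually P (nhdsin X l)"
  shows "\<forall>\<^sub>F h in F. P (f h)"
proof -
  have l: "l \<in> topspace X"
    using assms(1) by (rule limitin_topspace)
  then obtain S where S: "openin X S" "l \<in> S" "\<forall>y\<in>S. P y"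
    using assms(2) by (auto simp: eventually_nhdsin)
  then have "\<forall>\<^sub>F h in F. f h \<in> S"
    using assms(1) by (simp add: limitin_def)
  then show ?thesis
    by (rule eventually_mono) (use S in blast)
qed

text \<open>The curve \<open>h \<mapsto> (y h, h)\<close> converges along the filter of the limsup.
  If the limsup were below \<open>c\<close>, the quotients on the curve would eventually be below
  \<open>c\<close> too, a contradiction since \<open>at_right 0\<close> is nontrivial.\<close>

lemma le_clarke_dderiv:
  assumes lim: "limitin (Euclidean_space n) y x (at_right 0)"
    and le: "\<forall>\<^sub>F h in at_right 0. c \<le> (\<phi> (y h + h *\<^sub>v d) - \<phi> (y h)) / h"
  shows "ereal c \<le> clarke_dderiv n \<phi> x d"
proof (rule ccontr)
  let ?F = "nhdsin (Euclidean_space n) x \<times>\<^sub>F at_right (0::real)"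
  assume "\<not> ereal c \<le> clarke_dderiv n \<phi> x d"
  then have "\<forall>\<^sub>F p in ?F. (case p of (y, h) \<Rightarrow> ereal ((\<phi> (y + h *\<^sub>v d) - \<phi> y) / h)) < ereal c"
    unfolding clarke_dderiv_def by (intro Limsup_lessD) simp
  moreover have "filterlim y (nhdsin (Euclidean_space n) x) (at_right 0)"
    unfolding filterlim_iff using eventually_limitin_nhdsin[OF lim] by blast
  then have "filterlim (\<lambda>h. (y h, h)) ?F (at_right 0)"
    by (intro filterlim_Pair filterlim_ident)
  ultimately have "\<forall>\<^sub>F h in at_right 0. (\<phi> (y h + h *\<^sub>v d) - \<phi> (y h)) / h < c"
    unfolding filterlim_iff by fastforce
  with le have "\<forall>\<^sub>F h in at_right (0::real). False"
    by eventually_elim simp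
  then show False
    by simp
qed

lemma zero_in_clarke_subdiffI:
  assumes "\<And>d. d \<in> Rn n \<Longrightarrow> 0 \<le> clarke_dderiv n \<phi> x d"
  shows "0 \<in> clarke_subdiff n \<phi> x"
  using assms by (simp add: clarke_subdiff_def inner_Rn_def mem_Rn_iff zero_ereal_def)

text \<open>With the base point fixed at \<open>x\<close>, every quotient for small
  \<open>h > 0\<close> is nonnegative.\<close>

lemma zero_in_clarke_subdiff_local_min:
  assumes x: "x \<in> Rn n" and min: "\<forall>\<^sub>F y in nhdsin (Euclidean_space n) x. \<phi> x \<le> \<phi> y"
  shows "0 \<in> clarke_subdiff n \<phi> x"
proof (rule zero_in_clarke_subdiffI)
  fix d assume d: "d \<in> Rn n"
  have "\<forall>\<^sub>F h in at_right 0. \<phi> x \<le> \<phi> (x + (1 * h) *\<^sub>v d)"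
    using limitin_line[OF x d] min by (rule eventually_limitin_nhdsin)
  moreover have "\<forall>\<^sub>F h in at_right 0. (0::real) < h"
    by (rule eventually_at_right_less)
  ultimately have "\<forall>\<^sub>F h in at_right 0. 0 \<le> (\<phi> (x + h *\<^sub>v d) - \<phi> x) / h"
    by eventually_elim simp
  then show "0 \<le> clarke_dderiv n \<phi> x d"
    using le_clarke_dderiv[of n "\<lambda>_. x" x 0 \<phi> d] x by (simp add: limitin_const_iff zero_ereal_def)
qed

text \<open>
  At a maximum the difference quotients based at \<open>x\<close> itself have the wrong sign; those based at
  \<open>x - h d\<close> do not.
\<close>

lemma zero_in_clarke_subdiff_local_max:
  assumes x: "x \<in> Rn n" and max: "\<forall>\<^sub>F y in nhdsin (Euclidean_space n) x. \<phi> y \<le> \<phi> x"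
  shows "0 \<in> clarke_subdiff n \<phi> x"
proof (rule zero_in_clarke_subdiffI)
  fix d assume d: "d \<in> Rn n"
  note lim = limitin_line[OF x d, of "- 1"]
  have "\<forall>\<^sub>F h in at_right 0. \<phi> (x + (- 1 * h) *\<^sub>v d) \<le> \<phi> x"
    using lim max by (rule eventually_limitin_nhdsin)
  moreover have "\<forall>\<^sub>F h in at_right 0. (0::real) < h"
    by (rule eventually_at_right_less)
  ultimately have "\<forall>\<^sub>F h in at_right 0.
      0 \<le> (\<phi> (x + (- 1 * h) *\<^sub>v d + h *\<^sub>v d) - \<phi> (x + (- 1 * h) *\<^sub>v d)) / h"
  proof eventually_elim
    case (elim h)
    have "x + (- 1 * h) *\<^sub>v d + h *\<^sub>v d = x"
      by (auto simp: scale_vec_def)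
    with elim show ?case
      by (simp only:) simp
  qed
  from le_clarke_dderiv[OF lim this] show "0 \<le> clarke_dderiv n \<phi> x d"
    by (simp add: zero_ereal_def)
qed

lemma norm_Rn_1: "norm_Rn 1 x = \<bar>x 0\<bar>"
  by (simp add: norm_Rn_def L2_set_def)

lemma locally_Lipschitz_neg_abs: "locally_Lipschitz_Rn 1 (\<lambda>x. - \<bar>x 0\<bar>)"
  unfolding locally_Lipschitz_Rn_def norm_Rn_1
  by (intro ballI exI[of _ "1::real"] conjI) auto

lemma locally_Lipschitz_square: "locally_Lipschitz_Rn 1 (\<lambda>x. (x 0)\<^sup>2)"
  unfolding locally_Lipschitz_Rn_def
proof (intro ballI)
  fix x :: "nat \<Rightarrow> real"
  \<comment> \<open>Factor the difference of squares; on the unit ball around \<open>x\<close>, each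
    of \<open>y 0\<close> and \<open>z 0\<close> has modulus at most
    \<open>\<bar>x 0\<bar> + 1\<close>.\<close>
  have "\<bar>(y 0)\<^sup>2 - (z 0)\<^sup>2\<bar> \<le> (2 * \<bar>x 0\<bar> + 2) * norm_Rn 1 (y - z)"
    if "y \<in> cball_Rn 1 x 1" "z \<in> cball_Rn 1 x 1" for y z
  proof -
    have "\<bar>y 0 - x 0\<bar> \<le> 1" "\<bar>z 0 - x 0\<bar> \<le> 1"
      using that by (simp_all add: cball_Rn_def norm_Rn_1 del: One_nat_def)
    then have "\<bar>y 0 + z 0\<bar> \<le> 2 * \<bar>x 0\<bar> + 2"
      by linarith
    then have "\<bar>y 0 + z 0\<bar> * \<bar>y 0 - z 0\<bar> \<le> (2 * \<bar>x 0\<bar> + 2) * \<bar>y 0 - z 0\<bar>"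
      by (rule mult_right_mono) simp
    then show ?thesis
      by (simp add: norm_Rn_1 power2_eq_square square_diff_square_factored abs_mult del: One_nat_def)
  qed
  then show "\<exists>r>0. \<exists>L\<ge>0. \<forall>y\<in>cball_Rn 1 x r. \<forall>z\<in>cball_Rn 1 x r.
      \<bar>(y 0)\<^sup>2 - (z 0)\<^sup>2\<bar> \<le> L * norm_Rn 1 (y - z)"
    by (intro exI[of _ "1::real"] exI[of _ "2 * \<bar>x 0\<bar> + 2"] conjI ballI) auto
qed

theorem proposition4p17:
  shows "\<exists>(n::nat) (q::nat) (f :: (nat \<Rightarrow> real) \<Rightarrow> real) (g :: (nat \<Rightarrow> real) \<Rightarrow> (nat \<Rightarrow> real)) xb.
    n \<ge> 1 \<and> q \<ge> 1 \<and> locally_Lipschitz_problem n q f g \<and> solves n f g xb \<and>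
    subMFC n q f g xb \<and> \<not> Clarke_calm n q f g xb"
proof -
  \<comment> \<open>\<open>e\<close> identifies the real line with \<open>Rn 1\<close>.\<close>
  define e :: "real \<Rightarrow> nat \<Rightarrow> real" where "e t = (\<lambda>i. if i = 0 then t else 0)" for t
  define f :: "(nat \<Rightarrow> real) \<Rightarrow> real" where "f x = - \<bar>x 0\<bar>" for x
  define g :: "(nat \<Rightarrow> real) \<Rightarrow> nat \<Rightarrow> real" where "g x = e ((x 0)\<^sup>2)" for x
  have e0: "e t 0 = t" and e_Rn: "e t \<in> Rn 1" for t
    by (auto simp: e_def mem_Rn_iff)
  have zero_Rn: "0 \<in> Rn 1"
    by (simp add: mem_Rn_iff)

  have "locally_Lipschitz_problem 1 1 f g"
    using locally_Lipschitz_neg_abs locally_Lipschitz_square e_Rn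
    by (simp add: locally_Lipschitz_problem_def f_def[abs_def] g_def[abs_def] e0)
  moreover have "solves 1 f g 0"
  proof -
    have "y 0 = 0" if "g y \<le> 0" for y
      using le_funD[OF that, of 0] by (simp add: g_def e0)
    then show ?thesis
      by (auto simp: solves_def feasible_def f_def g_def e_def le_fun_def mem_Rn_iff)
  qed
  moreover have "subMFC 1 1 f g 0"
  proof -
    \<comment> \<open>Strictly positive for every \<open>k\<close>, including \<open>k = 0\<close>,
      so the constraint value \<open>0\<close> never meets the bound.\<close>
    define \<delta> :: "nat \<Rightarrow> nat \<Rightarrow> real" where "\<delta> k = e (1 / Suc k)" for k
    have f0: "0 \<in> clarke_subdiff 1 f 0"
      using zero_Rn by (rule zero_in_clarke_subdiff_local_max) (simp add: f_def)
    \<comment> \<open>Even with multiplier 0 this set must be shown nonempty: a Minkowski sum with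
      an empty summand is empty.\<close>
    have "0 \<in> clarke_subdiff 1 (\<lambda>y. g y 0) 0"
      using zero_Rn by (rule zero_in_clarke_subdiff_local_min) (simp add: g_def e0)
    then have "0 *\<^sub>v 0 \<in> (*\<^sub>v) 0 ` clarke_subdiff 1 (\<lambda>y. g y 0) 0"
      by (rule imageI)
    with f0 have "0 + 0 *\<^sub>v 0 \<in> clarke_subdiff 1 f 0 + (*\<^sub>v) 0 ` clarke_subdiff 1 (\<lambda>y. g y 0) 0"
      by (rule set_plus_intro)
    moreover have "0 + 0 *\<^sub>v 0 = 0"
      by (auto simp: scale_vec_def)
    ultimately have mem: "0 \<in> clarke_subdiff 1 f 0 + (*\<^sub>v) 0 ` clarke_subdiff 1 (\<lambda>y. g y 0) 0"
      by simp
    have "(\<lambda>k. \<delta> k i) \<longlonglongrightarrow> 0" for i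
      using LIMSEQ_inverse_real_of_nat by (cases "i = 0") (auto simp: \<delta>_def e_def inverse_eq_divide)
    then have "limitin (Euclidean_space 1) \<delta> 0 sequentially"
      using e_Rn zero_Rn by (simp add: limitin_Euclidean_space_iff \<delta>_def)
    moreover have "g 0 \<le> \<delta> k" for k
      by (auto simp: g_def \<delta>_def e_def le_fun_def)
    ultimately have "AKKT_sequence 1 1 f g 0 (\<lambda>_. 0) (\<lambda>_. 0) \<delta> (\<lambda>_. 0)"
      using mem zero_Rn e_Rn
      by (simp add: AKKT_sequence_def limitin_const_iff inner_Rn_def \<delta>_def)
    moreover have "{} = active 1 g 0 (\<delta> k)" for k
      by (auto simp: active_def g_def \<delta>_def e_def)
    ultimately show ?thesis
      unfolding subMFC_def by blast
  qed
  moreover have "\<not> Clarke_calm 1 1 f g 0"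
  proof
    assume "Clarke_calm 1 1 f g 0"
    then obtain r \<mu> where pos: "r > 0" "\<mu> > 0"
      and calm: "\<And>\<alpha> x. \<alpha> \<in> cball_Rn 1 0 r \<Longrightarrow> x \<in> cball_Rn 1 0 r \<Longrightarrow> g x + \<alpha> \<le> 0 \<Longrightarrow>
        0 \<le> f x - f 0 + \<mu> * norm_Rn 1 \<alpha>"
      unfolding Clarke_calm_def by blast
    \<comment> \<open>The bounds 1 and \<open>r\<close> put both \<open>t\<close> and
      \<open>t\<^sup>2\<close> within radius \<open>r\<close>; the last one forces
      \<open>\<mu> * t \<le> 1/2\<close>.\<close>
    define t where "t = min (min 1 r) (1 / (2 * \<mu>))"
    have t: "0 < t" "t \<le> 1" "t \<le> r" "t \<le> 1 / (2 * \<mu>)"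
      using pos by (auto simp: t_def)
    have "t\<^sup>2 \<le> r"
      using t mult_right_mono[of t 1 t] unfolding power2_eq_square by linarith
    \<comment> \<open>Here \<open>g x + \<alpha> = 0\<close> exactly, and calmness reads
      \<open>t \<le> \<mu> * t\<^sup>2\<close>.\<close>
    then have "0 \<le> f (e t) - f 0 + \<mu> * norm_Rn 1 (e (- t\<^sup>2))"
      using t e_Rn[unfolded e_def]
      by (intro calm) (auto simp: cball_Rn_def norm_Rn_1 e_def g_def le_fun_def simp del: One_nat_def)
    then have "0 \<le> t * (\<mu> * t - 1)"
      using t(1) by (simp add: f_def e0 norm_Rn_1 power2_eq_square algebra_simps del: One_nat_def)
    with t(1) have "1 \<le> \<mu> * t"
      by (simp add: zero_le_mult_iff)
    with t(4) pos show False
      by (simp add: field_simps)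
  qed
  ultimately show ?thesis
    by (intro exI[of _ "1::nat"] exI[of _ f] exI[of _ g] exI[of _ 0]) simp
qed

end
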